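(* Let $q\in\mathbb C^*$ with $q^2\neq1$, let $\Gamma_n^D$ denote the associated variety of $D_q(n)$, and let $((a_{ij}),(b_{ij}))\in\Gamma_n^D$. Then, for suitable choice of the representatives of the two projective points, one of the following holds: (1) there exist a non-zero $1\times n$ row $R$, a constant $c\in\mathbb C^*$ and row indices $s<i$ such that $(a_{ij})$ has $s$-th row $R$, $i$-th row $cR$ and all other rows $0$, while $(b_{ij})$ has $s$-th row $qR$, $i$-th row $cR$ and all other rows $0$; or (2) $(a_{ij})=\mathrm{diag}(A_1,A_2,\dots,A_n)$, where each $A_i$ is a $1\times s_i$ complex row vector for some integer $s_i\ge0$ with $s_1+\dots+s_n=n$ (i.e. row $i$ of the matrix is $A_i$ placed in columns $s_1+\dots+s_{i-1}+1,\dots,s_1+\dots+s_i$, and all other entries are $0$), and $(b_{ij})=(a_{ij})$.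
   Context: $D_q(n)$ (the Dipper–Donkin quantized matrix algebra) is the quadratic algebra with generators $D_{i,j}$, $1\le i,j\le n$, and relations $D_{i,j}D_{s,t}=qD_{s,t}D_{i,j}$ if $i>s$ and $j\le t$; $D_{i,j}D_{s,t}=D_{s,t}D_{i,j}+(q-1)D_{s,j}D_{i,t}$ if $i>s$ and $j>t$; $D_{i,j}D_{i,k}=D_{i,k}D_{i,j}$ for all $i,j,k$. For a quadratic algebra $T(V)/(R)$, $R\subset V\otimes V$, with basis $(x_k)$ of $V$, an element $f=\sum\alpha_{k,l}x_k\otimes x_l$ defines $f(p,p')=\sum\alpha_{k,l}x_k(p)x_l(p')$ for $p,p'\in V^*$, and the associated variety is $\Gamma(R)=\{(p,p')\in\mathbb P(V^* )\times\mathbb P(V^* ): f(p,p')=0\ \forall f\in R\}$. Here $V$ has basis $D_{i,j}$ and points of $\mathbb P(V^* )$ are represented by nonzero complex $n\times n$ matrices up to scalars, so $((a_{ij}),(b_{ij}))\in\Gamma_n^D$ means that the relations hold with each product $D_{i,j}D_{s,t}$ replaced by $a_{ij}b_{st}$. *)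

theory Defs
  imports Complex_Main "HOL-Library.Function_Algebras"
begin

text \<open>
  The vector space \<open>V\<close> with basis \<open>(x\<^sub>k)\<close>, \<open>k \<in> K\<close>, is modelled by the coefficient functions
  \<open>'k \<Rightarrow> complex\<close> vanishing outside \<open>K\<close>, and \<open>V \<otimes> V\<close> by the functions \<open>'k \<times> 'k \<Rightarrow> complex\<close>
  vanishing outside \<open>K \<times> K\<close>.  A point \<open>p\<close> of \<open>V\<^sup>*\<close> is modelled by its coordinates, so that
  \<open>p k\<close> stands for \<open>x\<^sub>k(p)\<close>.
\<close>

definition scale :: "complex \<Rightarrow> ('a \<Rightarrow> complex) \<Rightarrow> 'a \<Rightarrow> complex" where
  "scale c f = (\<lambda>x. c * f x)"

global_interpretation cfun: vector_space scale
  by unfold_locales (auto simp: scale_def fun_eq_iff algebra_simps)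

definition unit_vec :: "'k \<Rightarrow> 'k \<Rightarrow> complex" where
  "unit_vec k = (\<lambda>l. if l = k then 1 else 0)"

definition tensor :: "('k \<Rightarrow> complex) \<Rightarrow> ('k \<Rightarrow> complex) \<Rightarrow> 'k \<times> 'k \<Rightarrow> complex"
    (infixl "\<otimes>" 70) where
  "u \<otimes> v = (\<lambda>(k, l). u k * v l)"

definition bieval ::
    "'k set \<Rightarrow> ('k \<times> 'k \<Rightarrow> complex) \<Rightarrow> ('k \<Rightarrow> complex) \<Rightarrow> ('k \<Rightarrow> complex) \<Rightarrow> complex" where
  "bieval K f p p' = (\<Sum>k\<in>K. \<Sum>l\<in>K. f (k, l) * p k * p' l)"

definition nonzero_points :: "'k set \<Rightarrow> ('k \<Rightarrow> complex) set" where
  "nonzero_points K = {p. (\<forall>k. k \<notin> K \<longrightarrow> p k = 0) \<and> p \<noteq> 0}"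

definition proportional :: "'k set \<Rightarrow> (('k \<Rightarrow> complex) \<times> ('k \<Rightarrow> complex)) set" where
  "proportional K =
     {(p, p'). p \<in> nonzero_points K \<and> p' \<in> nonzero_points K \<and> (\<exists>c. c \<noteq> 0 \<and> p' = scale c p)}"

lemma equiv_proportional: "equiv (nonzero_points K) (proportional K)"
proof (rule equivI)
  show "proportional K \<subseteq> nonzero_points K \<times> nonzero_points K"
    by (auto simp: proportional_def)
  show "refl_on (nonzero_points K) (proportional K)"
    by (auto simp: refl_on_def proportional_def intro!: exI[of _ 1])
  show "sym (proportional K)"
  proof (rule symI)
    fix p p' assume "(p, p') \<in> proportional K"
    then obtain c where "c \<noteq> 0" "p' = scale c p"
        and "p \<in> nonzero_points K" "p' \<in> nonzero_points K"
      by (auto simp: proportional_def)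
    then show "(p', p) \<in> proportional K"
      by (auto simp: proportional_def intro!: exI[of _ "inverse c"])
  qed
  show "trans (proportional K)"
    by (auto simp: trans_def proportional_def) (metis mult_eq_0_iff)
qed

text \<open>
  Points of the projective space \<open>P(V\<^sup>*)\<close> are proportionality classes, so the representatives of
  a projective point are precisely its elements.
\<close>

definition proj_space :: "'k set \<Rightarrow> ('k \<Rightarrow> complex) set set" where
  "proj_space K = nonzero_points K // proportional K"

text \<open>
  Vanishing is required on all pairs of representatives; by homogeneity one pair suffices
  (lemma \<open>assoc_variety_iff\<close> below).
\<close>

definition assoc_variety ::
    "'k set \<Rightarrow> ('k \<times> 'k \<Rightarrow> complex) set \<Rightarrow> (('k \<Rightarrow> complex) set \<times> ('k \<Rightarrow> complex) set) set" where
  "assoc_variety K R =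
     {(P, P') \<in> proj_space K \<times> proj_space K.
        \<forall>f\<in>R. \<forall>p\<in>P. \<forall>p'\<in>P'. bieval K f p p' = 0}"

lemma bieval_scale:
  "bieval K f (scale c p) (scale d p') = c * d * bieval K f p p'"
  by (simp add: bieval_def scale_def sum_distrib_left mult_ac)

lemma assoc_variety_iff:
  assumes "p \<in> nonzero_points K" "p' \<in> nonzero_points K"
  shows "(proportional K `` {p}, proportional K `` {p'}) \<in> assoc_variety K R \<longleftrightarrow>
         (\<forall>f\<in>R. bieval K f p p' = 0)"
proof -
  have "p \<in> proportional K `` {p}" "p' \<in> proportional K `` {p'}"
    using assms equiv_class_self[OF equiv_proportional] by auto
  moreover have "bieval K f r r' = 0"
    if "bieval K f p p' = 0" "r \<in> proportional K `` {p}" "r' \<in> proportional K `` {p'}" for f r r'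
    using that by (auto simp: proportional_def bieval_scale)
  ultimately show ?thesis
    using assms by (auto simp: assoc_variety_def proj_space_def quotientI)
qed

text \<open>
  The Dipper--Donkin algebra is \<open>D\<^sub>q(n) = T(V) / (R)\<close>.  The associated variety is a function of
  the quadratic presentation, that is, of the basis of \<open>V\<close> and of the relation space \<open>R\<close>, so
  the quotient of the tensor algebra itself is not constructed.  A matrix \<open>a\<close> has the entry
  \<open>a (i, j)\<close> in row \<open>i\<close> and column \<open>j\<close>.
\<close>

definition dd_gens :: "nat \<Rightarrow> (nat \<times> nat) set" where
  "dd_gens n = {1..n} \<times> {1..n}"

abbreviation dd_gen :: "nat \<Rightarrow> nat \<Rightarrow> nat \<times> nat \<Rightarrow> complex" where
  "dd_gen i j \<equiv> unit_vec (i, j)"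

definition dd_relators :: "complex \<Rightarrow> nat \<Rightarrow> ((nat \<times> nat) \<times> (nat \<times> nat) \<Rightarrow> complex) set" where
  "dd_relators q n =
     {dd_gen i j \<otimes> dd_gen s t - scale q (dd_gen s t \<otimes> dd_gen i j) | i j s t.
        {i, j, s, t} \<subseteq> {1..n} \<and> i > s \<and> j \<le> t}
   \<union> {dd_gen i j \<otimes> dd_gen s t
        - (dd_gen s t \<otimes> dd_gen i j + scale (q - 1) (dd_gen s j \<otimes> dd_gen i t)) | i j s t.
        {i, j, s, t} \<subseteq> {1..n} \<and> i > s \<and> j > t}
   \<union> {dd_gen i j \<otimes> dd_gen i k - dd_gen i k \<otimes> dd_gen i j | i j k.
        {i, j, k} \<subseteq> {1..n}}"

definition dd_relation_space ::
    "complex \<Rightarrow> nat \<Rightarrow> ((nat \<times> nat) \<times> (nat \<times> nat) \<Rightarrow> complex) set" where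
  "dd_relation_space q n = cfun.span (dd_relators q n)"

definition dd_variety ::
    "complex \<Rightarrow> nat \<Rightarrow> ((nat \<times> nat \<Rightarrow> complex) set \<times> (nat \<times> nat \<Rightarrow> complex) set) set" where
  "dd_variety q n = assoc_variety (dd_gens n) (dd_relation_space q n)"

definition two_row_matrix ::
    "nat \<Rightarrow> nat \<Rightarrow> (nat \<Rightarrow> complex) \<Rightarrow> nat \<Rightarrow> (nat \<Rightarrow> complex) \<Rightarrow> nat \<times> nat \<Rightarrow> complex" where
  "two_row_matrix n s u i v =
     (\<lambda>(k, j). if j \<notin> {1..n} then 0 else if k = s then u j else if k = i then v j else 0)"

text \<open>
  \<open>diag_rows n s A\<close> is \<open>diag(A\<^sub>1, \<dots>, A\<^sub>n)\<close>, where \<open>A\<^sub>i\<close> is the \<open>1 \<times> s i\<close> row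
  \<open>(A i 1, \<dots>, A i (s i))\<close>; values \<open>A i m\<close> with \<open>m\<close> outside \<open>{1..s i}\<close> are not used.
\<close>

definition diag_rows ::
    "nat \<Rightarrow> (nat \<Rightarrow> nat) \<Rightarrow> (nat \<Rightarrow> nat \<Rightarrow> complex) \<Rightarrow> nat \<times> nat \<Rightarrow> complex" where
  "diag_rows n s A =
     (\<lambda>(i, j). if i \<in> {1..n} \<and> j \<in> {(\<Sum>k = 1..<i. s k) + 1..(\<Sum>k = 1..i. s k)}
               then A i (j - (\<Sum>k = 1..<i. s k)) else 0)"

end

theory Submission
  imports Defs
begin

text \<open>
  Evaluated at a point, the relations become bilinear equations between the rows of \<open>a\<close> and \<open>b\<close>.
  The relations inside one row say that row \<open>i\<close> of \<open>a\<close> and row \<open>i\<close> of \<open>b\<close> are linearly dependent,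
  and the relations between two rows force them to vanish simultaneously; hence
  \<open>b\<^sub>i = l\<^sub>i a\<^sub>i\<close> with \<open>l\<^sub>i \<noteq> 0\<close> (\<open>row_factors\<close>).

  Substituting this, two nonzero rows \<open>s < i\<close> of \<open>a\<close> satisfy
  \<open>(l\<^sub>s - q l\<^sub>i) a\<^sub>i\<^sub>j a\<^sub>s\<^sub>t = 0\<close> for \<open>j \<le> t\<close> and
  \<open>(l\<^sub>s - l\<^sub>i) a\<^sub>i\<^sub>j a\<^sub>s\<^sub>t = (q - 1) l\<^sub>i a\<^sub>s\<^sub>j a\<^sub>i\<^sub>t\<close> for \<open>j > t\<close>.
  So either \<open>l\<^sub>s = l\<^sub>i\<close> and the support of row \<open>s\<close> lies strictly to the left of that of row \<open>i\<close>, or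
  \<open>l\<^sub>s = q l\<^sub>i\<close> and the two rows are proportional (\<open>row_pair_cases\<close>).

  The second alternative tolerates no third nonzero row (\<open>proportional_pair_exhausts\<close>): of three
  rows, the quotients of the factors multiply, and since \<open>q\<^sup>2\<close> is neither \<open>1\<close> nor \<open>q\<close> exactly one
  of the two consecutive quotients would be \<open>q\<close>; then two rows with disjoint supports would both
  be proportional to the remaining one.  That is the two-row case.  If the second alternative
  never occurs, all \<open>l\<^sub>i\<close> agree, so \<open>b\<close> can be rescaled to \<open>a\<close>, and a matrix whose row supports
  move strictly to the right is block diagonal with row blocks (\<open>staircase_diag_rows\<close>).
\<close>

section \<open>The equations of the associated variety\<close>

lemma bieval_add: "bieval K (f + g) p p' = bieval K f p p' + bieval K g p p'"
  by (simp add: bieval_def algebra_simps sum.distrib)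

lemma bieval_diff: "bieval K (f - g) p p' = bieval K f p p' - bieval K g p p'"
  by (simp add: bieval_def algebra_simps sum_subtractf)

lemma bieval_scale_form: "bieval K (scale c f) p p' = c * bieval K f p p'"
  by (simp add: bieval_def scale_def sum_distrib_left mult_ac)

lemma bieval_unit_vec_tensor:
  assumes "finite K" "k \<in> K" "l \<in> K"
  shows "bieval K (unit_vec k \<otimes> unit_vec l) p p' = p k * p' l"
proof -
  have "bieval K (unit_vec k \<otimes> unit_vec l) p p' =
      (\<Sum>x\<in>K. \<Sum>y\<in>K. if y = l then (if x = k then p x * p' y else 0) else 0)"
    unfolding bieval_def by (intro sum.cong refl) (auto simp: tensor_def unit_vec_def)
  also have "\<dots> = p k * p' l"
    using assms by simp
  finally show ?thesis .
qed

text \<open>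
  The equations are required for all indices, not only those in \<open>{1..n}\<close>: for matrices vanishing
  outside the index range, every term of an equation with an index out of range is zero, and
  the arguments below are then free of range conditions.
\<close>

locale dd_zero =
  fixes q :: complex and a b :: "nat \<times> nat \<Rightarrow> complex"
  assumes q_nonzero: "q \<noteq> 0" and q_square: "q\<^sup>2 \<noteq> 1"
    and a_nonzero: "a \<noteq> 0" and b_nonzero: "b \<noteq> 0"
    and weakly_left: "s < i \<Longrightarrow> j \<le> t \<Longrightarrow> a (i, j) * b (s, t) = q * (a (s, t) * b (i, j))"
    and right: "s < i \<Longrightarrow> t < j \<Longrightarrow>
      a (i, j) * b (s, t) = a (s, t) * b (i, j) + (q - 1) * (a (s, j) * b (i, t))"
    and same_row: "a (i, j) * b (i, k) = a (i, k) * b (i, j)"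

lemma dd_zeroI:
  assumes "q \<noteq> 0" "q\<^sup>2 \<noteq> 1"
    and a: "a \<in> nonzero_points (dd_gens n)" and b: "b \<in> nonzero_points (dd_gens n)"
    and vanish: "\<And>f. f \<in> dd_relators q n \<Longrightarrow> bieval (dd_gens n) f a b = 0"
  shows "dd_zero q a b"
proof
  have fin: "finite (dd_gens n)"
    and mem: "(i, j) \<in> dd_gens n \<longleftrightarrow> i \<in> {1..n} \<and> j \<in> {1..n}" for i j
    by (simp_all add: dd_gens_def)
  have outside: "a (i, j) = 0" "b (i, j) = 0" if "i \<notin> {1..n} \<or> j \<notin> {1..n}" for i j
    using that a b by (auto simp: nonzero_points_def dd_gens_def)
  note eval = bieval_diff bieval_add bieval_scale_form bieval_unit_vec_tensor[OF fin]
  show "a (i, j) * b (s, t) = q * (a (s, t) * b (i, j))" if "s < i" "j \<le> t" for s i j t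
  proof (cases "{i, j, s, t} \<subseteq> {1..n}")
    case True
    then have "dd_gen i j \<otimes> dd_gen s t - scale q (dd_gen s t \<otimes> dd_gen i j) \<in> dd_relators q n"
      unfolding dd_relators_def using that by blast
    from vanish[OF this] show ?thesis
      using True by (simp add: eval mem)
  next
    case False
    then show ?thesis
      using outside[of i j] outside[of s t] by auto
  qed
  show "a (i, j) * b (s, t) = a (s, t) * b (i, j) + (q - 1) * (a (s, j) * b (i, t))"
    if "s < i" "t < j" for s i t j
  proof (cases "{i, j, s, t} \<subseteq> {1..n}")
    case True
    then have "dd_gen i j \<otimes> dd_gen s t
        - (dd_gen s t \<otimes> dd_gen i j + scale (q - 1) (dd_gen s j \<otimes> dd_gen i t)) \<in> dd_relators q n"
      unfolding dd_relators_def using that by blast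
    from vanish[OF this] show ?thesis
      using True by (simp add: eval mem)
  next
    case False
    then show ?thesis
      using outside[of i j] outside[of s t] outside[of s j] outside[of i t] by auto
  qed
  show "a (i, j) * b (i, k) = a (i, k) * b (i, j)" for i j k
  proof (cases "{i, j, k} \<subseteq> {1..n}")
    case True
    then have "dd_gen i j \<otimes> dd_gen i k - dd_gen i k \<otimes> dd_gen i j \<in> dd_relators q n"
      unfolding dd_relators_def by blast
    from vanish[OF this] show ?thesis
      using True by (simp add: eval mem)
  next
    case False
    then show ?thesis
      using outside[of i j] outside[of i k] by auto
  qed
qed (use assms in \<open>auto simp: nonzero_points_def\<close>)

section \<open>Proportionality of corresponding rows\<close>

context dd_zero
begin

text \<open>
  The vanishing row is compared with a nonzero row \<open>s\<close> of the same matrix.  One of the two products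
  drops out of the weakly left equations, so the other vanishes for columns in weakly
  increasing order.  The mixed term of the right equations is then zero, either because it
  contains the vanishing row or because it is one of these products, and what remains of the
  right equations covers the other column order.
\<close>

lemma zero_row_transfer:
  assumes "\<And>j. a (i, j) = 0"
  shows "b (i, j) = 0"
proof (rule ccontr)
  assume bij: "b (i, j) \<noteq> 0"
  obtain s t where ast: "a (s, t) \<noteq> 0"
    using a_nonzero by (auto simp: fun_eq_iff)
  then consider "s < i" | "i < s"
    using assms by (metis nat_neq_iff)
  then show False
  proof cases
    case 1
    have left: "a (s, v) * b (i, u) = 0" if "u \<le> v" for u v
      using weakly_left[OF 1 that] assms q_nonzero by auto
    show False
    proof (cases "j \<le> t")
      case True
      then show False using left[of j t] ast bij by simp
    next
      case False
      then show False
        using right[OF 1, of t j] left[of t j] assms ast bij by simp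
    qed
  next
    case 2
    show False
    proof (cases "t \<le> j")
      case True
      then show False using weakly_left[OF 2, of t j] assms ast bij by simp
    next
      case False
      then show False
        using right[OF 2, of j t] assms ast bij by simp
    qed
  qed
qed

lemma zero_row_transfer_back:
  assumes "\<And>j. b (i, j) = 0"
  shows "a (i, j) = 0"
proof (rule ccontr)
  assume aij: "a (i, j) \<noteq> 0"
  obtain s t where bst: "b (s, t) \<noteq> 0"
    using b_nonzero by (auto simp: fun_eq_iff)
  then consider "s < i" | "i < s"
    using assms by (metis nat_neq_iff)
  then show False
  proof cases
    case 1
    show False
    proof (cases "j \<le> t")
      case True
      then show False using weakly_left[OF 1, of j t] assms aij bst by simp
    next
      case False
      then show False
        using right[OF 1, of t j] assms aij bst by simp
    qed
  next
    case 2
    have left: "a (i, v) * b (s, u) = 0" if "u \<le> v" for u v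
      using weakly_left[OF 2 that] assms q_nonzero by auto
    show False
    proof (cases "t \<le> j")
      case True
      then show False using left[of t j] aij bst by simp
    next
      case False
      then show False
        using right[OF 2, of j t] left[of j t] assms aij bst by simp
    qed
  qed
qed

lemma row_factors:
  obtains l where "\<And>i. l i \<noteq> 0" and "\<And>i j. b (i, j) = l i * a (i, j)"
proof -
  have "\<exists>c. c \<noteq> 0 \<and> (\<forall>j. b (i, j) = c * a (i, j))" for i
  proof (cases "\<forall>j. a (i, j) = 0")
    case True
    then show ?thesis
      using zero_row_transfer[of i] by (auto intro!: exI[of _ 1])
  next
    case False
    then obtain j where aij: "a (i, j) \<noteq> 0"
      by blast
    define c where "c = b (i, j) / a (i, j)"
    have row: "b (i, k) = c * a (i, k)" for k
      using same_row[of i j k] aij by (simp add: c_def field_simps)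
    moreover have "c \<noteq> 0"
      using row zero_row_transfer_back[of i j] aij by auto
    ultimately show ?thesis
      by blast
  qed
  then show ?thesis
    using that by metis
qed

end

section \<open>Pairs and triples of nonzero rows\<close>

locale dd_zero_rows = dd_zero +
  fixes l :: "nat \<Rightarrow> complex"
  assumes factor_nonzero: "l i \<noteq> 0"
    and factor: "b (i, j) = l i * a (i, j)"
begin

lemma row_pair_cases:
  assumes "s < i" and as: "a (s, u) \<noteq> 0" and ai: "a (i, v) \<noteq> 0"
  obtains (separated) "l s = l i" "\<And>j t. a (s, t) \<noteq> 0 \<Longrightarrow> a (i, j) \<noteq> 0 \<Longrightarrow> t < j"
  | (parallel) "l s = q * l i" "\<And>j t. a (i, j) * a (s, t) = a (s, j) * a (i, t)"
proof (cases "l s = q * l i")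
  case True
  have minor: "a (i, j) * a (s, t) = a (s, j) * a (i, t)" if "t < j" for j t
  proof -
    have "(q - 1) * l i * (a (i, j) * a (s, t) - a (s, j) * a (i, t)) = 0"
      using right[OF \<open>s < i\<close> that] True by (simp add: factor algebra_simps)
    moreover have "q \<noteq> 1"
      using q_square by auto
    ultimately show ?thesis
      using factor_nonzero by simp
  qed
  have "a (i, j) * a (s, t) = a (s, j) * a (i, t)" for j t
  proof (cases t j rule: linorder_cases)
    case less
    then show ?thesis by (rule minor)
  next
    case equal
    then show ?thesis by simp
  next
    case greater
    then have "a (i, t) * a (s, j) = a (s, t) * a (i, j)"
      by (rule minor)
    then show ?thesis by (metis mult.commute)
  qed
  with True show ?thesis
    by (rule parallel)
next
  case False
  have left: "a (i, j) * a (s, t) = 0" if "j \<le> t" for j t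
  proof -
    have "(l s - q * l i) * (a (i, j) * a (s, t)) = 0"
      using weakly_left[OF \<open>s < i\<close> that] by (simp add: factor algebra_simps)
    then show ?thesis
      using False by simp
  qed
  then have order: "t < j" if "a (s, t) \<noteq> 0" "a (i, j) \<noteq> 0" for j t
    using that by (meson mult_eq_0_iff not_le)
  have "u < v"
    using order[OF as ai] .
  then have "(l s - l i) * (a (i, v) * a (s, u)) = (q - 1) * l i * (a (s, v) * a (i, u))"
    using right[OF \<open>s < i\<close>, of u v] by (simp add: factor algebra_simps)
  also have "\<dots> = 0"
    using left[of u v] \<open>u < v\<close> by auto
  finally have "l s = l i"
    using as ai by simp
  then show ?thesis
    using order by (rule separated)
qed

text \<open>
  Separated rows have disjoint supports, so this is what excludes, for a triple of nonzero rows,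
  two parallel pairs next to a separated one.
\<close>

lemma parallel_same_support:
  assumes "\<And>j t. a (i, j) * a (s, t) = a (s, j) * a (i, t)" "a (s, u) \<noteq> 0" "a (i, v) \<noteq> 0"
  shows "a (s, t) \<noteq> 0 \<longleftrightarrow> a (i, t) \<noteq> 0"
  using assms(1)[of u t] assms(1)[of v t] assms(2,3) by auto

text \<open>
  The quotient \<open>l r / l t\<close> is \<open>1\<close> or \<open>q\<close>, and it is the product of \<open>l r / l s\<close> and
  \<open>l s / l t\<close>.  These cannot both be \<open>q\<close>, as \<open>q\<^sup>2\<close> is neither \<open>1\<close> nor \<open>q\<close>.  If exactly one of
  them is \<open>q\<close>, then so is \<open>l r / l t\<close>, and rows \<open>r\<close> and \<open>t\<close> are parallel; all three rows then have
  the same support, although one of the consecutive pairs is separated.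
\<close>

lemma three_rows_equal_factors:
  assumes "r < s" "s < t"
    and "a (r, x) \<noteq> 0" "a (s, y) \<noteq> 0" "a (t, z) \<noteq> 0"
  shows "l r = l s" "l s = l t"
proof -
  have q: "q \<noteq> 1" "q * q \<noteq> 1" "q * q \<noteq> q"
    using q_square q_nonzero by (auto simp: power2_eq_square)
  have "r < t"
    using assms by simp
  have both: "l r = l s \<and> l s = l t"
    using assms(1,3,4)
  proof (cases rule: row_pair_cases)
    case rs: separated
    show ?thesis
      using assms(2,4,5)
    proof (cases rule: row_pair_cases)
      case separated
      with rs show ?thesis by simp
    next
      case st: parallel
      show ?thesis
        using \<open>r < t\<close> assms(3,5)
      proof (cases rule: row_pair_cases)
        case separated
        then show ?thesis using rs st q factor_nonzero[of t] by simp
      next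
        case parallel
        have "a (s, x) \<noteq> 0"
          using parallel_same_support[OF parallel(2) assms(3,5), of x]
            parallel_same_support[OF st(2) assms(4,5), of x] assms(3) by simp
        then show ?thesis
          using rs(2)[OF assms(3)] by blast
      qed
    qed
  next
    case rs: parallel
    show ?thesis
      using assms(2,4,5)
    proof (cases rule: row_pair_cases)
      case st: separated
      show ?thesis
        using \<open>r < t\<close> assms(3,5)
      proof (cases rule: row_pair_cases)
        case separated
        then show ?thesis using rs st q factor_nonzero[of t] by simp
      next
        case parallel
        have "a (t, y) \<noteq> 0"
          using parallel_same_support[OF parallel(2) assms(3,5), of y]
            parallel_same_support[OF rs(2) assms(3,4), of y] assms(4) by simp
        then show ?thesis
          using st(2)[OF assms(4)] by blast
      qed
    next
      case st: parallel
      show ?thesis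
        using \<open>r < t\<close> assms(3,5)
        by (cases rule: row_pair_cases) (use rs st q factor_nonzero[of t] in auto)
    qed
  qed
  then show "l r = l s" "l s = l t"
    by simp_all
qed

lemma proportional_pair_exhausts:
  assumes "s < i" "a (s, u) \<noteq> 0" "a (i, v) \<noteq> 0" "l s \<noteq> l i" "a (k, w) \<noteq> 0"
  shows "k = s \<or> k = i"
proof (rule ccontr)
  assume "\<not> (k = s \<or> k = i)"
  then consider "k < s" | "s < k" "k < i" | "i < k"
    by linarith
  then show False
    using three_rows_equal_factors assms by cases metis+
qed

end

section \<open>Block-diagonal shape\<close>

text \<open>
  The last column of block \<open>i\<close> is taken to be the last column occupied by one of the rows
  \<open>1, \<dots>, i\<close>, except that block \<open>n\<close> absorbs all remaining columns so that the widths add up to \<open>n\<close>.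
\<close>

lemma staircase_diag_rows:
  assumes range: "\<And>i j. a (i, j) \<noteq> 0 \<Longrightarrow> i \<in> {1..n} \<and> j \<in> {1..n}"
    and stair: "\<And>r i t j. r < i \<Longrightarrow> a (r, t) \<noteq> 0 \<Longrightarrow> a (i, j) \<noteq> 0 \<Longrightarrow> t < j"
  shows "\<exists>s A. (\<Sum>i = 1..n. s i) = n \<and> a = diag_rows n s A"
proof -
  define C where "C i = insert 0 {j. \<exists>k\<le>i. a (k, j) \<noteq> 0}" for i
  define S where "S i = (if i = n then n else Max (C i))" for i
  define s where "s i = S i - S (i - 1)" for i
  have C_le: "j \<le> n" if "j \<in> C i" for i j
    using that range by (auto simp: C_def)
  then have fin: "finite (C i)" for i
    by (meson finite_nat_set_iff_bounded_le)
  have in_C: "Max (C i) \<in> C i" for i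
    using fin by (intro Max_in) (auto simp: C_def)
  have le_Max: "j \<le> Max (C i)" if "a (k, j) \<noteq> 0" "k \<le> i" for i j k
    using fin that by (intro Max_ge) (auto simp: C_def)
  have "a (0, j) = 0" for j
    using range[of 0 j] by auto
  then have S0: "S 0 = 0"
    by (simp add: S_def C_def)
  have Suc_le: "S i \<le> S (Suc i)" if "i < n" for i
  proof -
    have "Max (C i) \<le> Max (C (Suc i))"
      using fin by (intro Max_mono) (auto simp: C_def intro: le_SucI)
    then show ?thesis
      using that C_le[OF in_C] by (auto simp: S_def)
  qed
  have sum_s: "(\<Sum>k = 1..i. s k) = S i" if "i \<le> n" for i
    using that
  proof (induction i)
    case 0
    then show ?case by (simp add: S0)
  next
    case (Suc i)
    then show ?case using Suc_le[of i] by (simp add: s_def)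
  qed
  have sum_s': "(\<Sum>k = 1..<i. s k) = S (i - 1)" if "1 \<le> i" "i \<le> n" for i
    using that sum_s[of "i - 1"] by (cases i) (auto simp: atLeastLessThanSuc_atLeastAtMost)
  have support: "S (i - 1) < j \<and> j \<le> S i" if "a (i, j) \<noteq> 0" for i j
  proof
    have ij: "1 \<le> i" "i \<le> n" "1 \<le> j" "j \<le> n"
      using range[OF that] by auto
    show "j \<le> S i"
      using ij le_Max[OF that order_refl] by (simp add: S_def)
    have "m < j" if "m \<in> C (i - 1)" for m
    proof -
      consider "m = 0" | k where "k \<le> i - 1" "a (k, m) \<noteq> 0"
        using \<open>m \<in> C (i - 1)\<close> by (auto simp: C_def)
      then show ?thesis
      proof cases
        case 1
        then show ?thesis using ij by simp
      next
        case (2 k)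
        then have "k < i"
          using ij by linarith
        then show ?thesis
          using 2(2) \<open>a (i, j) \<noteq> 0\<close> by (rule stair)
      qed
    qed
    from this[OF in_C] show "S (i - 1) < j"
      using ij by (simp add: S_def)
  qed
  have "a = diag_rows n s (\<lambda>i m. a (i, m + S (i - 1)))"
  proof
    fix x :: "nat \<times> nat"
    obtain i j where x: "x = (i, j)"
      by (cases x)
    show "a x = diag_rows n s (\<lambda>i m. a (i, m + S (i - 1))) x"
    proof (cases "i \<in> {1..n}")
      case True
      then show ?thesis
        using sum_s[of i] sum_s'[of i] support[of i j]
        by (cases "a (i, j) = 0") (auto simp: x diag_rows_def)
    next
      case False
      then show ?thesis
        using range[of i j] by (auto simp: x diag_rows_def)
    qed
  qed
  moreover have "(\<Sum>i = 1..n. s i) = n"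
    using sum_s[of n] by (simp add: S_def)
  ultimately show ?thesis
    by blast
qed

section \<open>The points of the associated variety\<close>

theorem theorem8p6:
  fixes q :: complex and n :: nat and P P' :: "(nat \<times> nat \<Rightarrow> complex) set"
  assumes "q \<noteq> 0" and "q\<^sup>2 \<noteq> 1"
    and "(P, P') \<in> dd_variety q n"
  shows "\<exists>a\<in>P. \<exists>b\<in>P'.
    (\<exists>(R :: nat \<Rightarrow> complex) (c :: complex) s i.
        (\<exists>j\<in>{1..n}. R j \<noteq> 0) \<and> c \<noteq> 0 \<and> s \<in> {1..n} \<and> i \<in> {1..n} \<and> s < i \<and>
        a = two_row_matrix n s R i (\<lambda>j. c * R j) \<and>
        b = two_row_matrix n s (\<lambda>j. q * R j) i (\<lambda>j. c * R j))
    \<or> (\<exists>(s :: nat \<Rightarrow> nat) (A :: nat \<Rightarrow> nat \<Rightarrow> complex).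
        (\<Sum>i = 1..n. s i) = n \<and> a = diag_rows n s A \<and> b = a)"
proof -
  let ?K = "dd_gens n"
  obtain a b where a: "a \<in> nonzero_points ?K" and P: "P = proportional ?K `` {a}"
    and b: "b \<in> nonzero_points ?K" and P': "P' = proportional ?K `` {b}"
    using assms(3) by (auto simp: dd_variety_def assoc_variety_def proj_space_def elim!: quotientE)
  have aP: "a \<in> P"
    using a unfolding P by (rule equiv_class_self[OF equiv_proportional])
  have scaled: "scale c b \<in> P'" if "c \<noteq> 0" for c
    using that b unfolding P'
    by (auto simp: proportional_def nonzero_points_def scale_def fun_eq_iff)
  have "bieval ?K f a b = 0" if "f \<in> dd_relators q n" for f
    using assms(3) a b cfun.span_base[OF that]
    unfolding dd_variety_def P P' dd_relation_space_def by (simp add: assoc_variety_iff)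
  then interpret dd_zero q a b
    using dd_zeroI[OF assms(1,2) a b] by blast
  obtain l where "\<And>i. l i \<noteq> 0" "\<And>i j. b (i, j) = l i * a (i, j)"
    using row_factors by blast
  then interpret dd_zero_rows q a b l
    by unfold_locales
  have range: "i \<in> {1..n} \<and> j \<in> {1..n}" if "a (i, j) \<noteq> 0" for i j
    using that a by (auto simp: nonzero_points_def dd_gens_def)
  show ?thesis
  proof (cases "\<exists>s i u v. s < i \<and> a (s, u) \<noteq> 0 \<and> a (i, v) \<noteq> 0 \<and> l s \<noteq> l i")
    case True
    then obtain s i u v where si: "s < i" "a (s, u) \<noteq> 0" "a (i, v) \<noteq> 0" "l s \<noteq> l i"
      by blast
    have ls: "l s = q * l i" and minor: "\<And>j t. a (i, j) * a (s, t) = a (s, j) * a (i, t)"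
      using row_pair_cases[OF si(1-3)] si(4) by metis+
    define R where "R j = a (s, j)" for j
    define c where "c = a (i, u) / a (s, u)"
    have row_i: "a (i, j) = c * R j" for j
      using minor[of j u] si(2) by (simp add: R_def c_def field_simps)
    have "c \<noteq> 0"
      using row_i[of v] si(3) by auto
    have others: "a (k, j) = 0" if "k \<noteq> s" "k \<noteq> i" for k j
      using proportional_pair_exhausts[OF si] that by blast
    have cols: "a (k, j) = 0" if "j \<notin> {1..n}" for k j
      using range that by blast
    have "a = two_row_matrix n s R i (\<lambda>j. c * R j)"
      using others cols row_i by (auto simp: fun_eq_iff two_row_matrix_def R_def)
    \<comment> \<open>Normalising \<open>b\<close> by \<open>l i\<close> turns the row factors \<open>q * l i\<close> and \<open>l i\<close> into \<open>q\<close> and \<open>1\<close>.\<close>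
    moreover define b' where "b' = scale (1 / l i) b"
    have "b' = two_row_matrix n s (\<lambda>j. q * R j) i (\<lambda>j. c * R j)"
      using others cols row_i factor_nonzero[of i] ls
      by (auto simp: b'_def fun_eq_iff two_row_matrix_def R_def scale_def factor)
    moreover have "\<exists>j\<in>{1..n}. R j \<noteq> 0"
      using si(2) range[of s u] by (auto simp: R_def)
    moreover have "s \<in> {1..n}" "i \<in> {1..n}"
      using si(2,3) range by blast+
    ultimately have "\<exists>R c s i.
        (\<exists>j\<in>{1..n}. R j \<noteq> 0) \<and> c \<noteq> 0 \<and> s \<in> {1..n} \<and> i \<in> {1..n} \<and> s < i \<and>
        a = two_row_matrix n s R i (\<lambda>j. c * R j) \<and>
        b' = two_row_matrix n s (\<lambda>j. q * R j) i (\<lambda>j. c * R j)"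
      using \<open>c \<noteq> 0\<close> si(1)
      by - (rule exI[of _ R], rule exI[of _ c], rule exI[of _ s], rule exI[of _ i], intro conjI)
    moreover have "b' \<in> P'"
      using scaled factor_nonzero by (simp add: b'_def)
    ultimately show ?thesis
      by (intro bexI[OF _ aP] bexI[where x = b'] disjI1)
  next
    case False
    then have equal: "l r = l i" if "a (r, t) \<noteq> 0" "a (i, j) \<noteq> 0" for r i t j
      using that by (metis nat_neq_iff)
    have stair: "t < j" if rows: "r < i" "a (r, t) \<noteq> 0" "a (i, j) \<noteq> 0" for r i t j
      using rows
    proof (cases rule: row_pair_cases)
      case separated
      then show ?thesis using rows by blast
    next
      case parallel
      \<comment> \<open>Equal factors would force \<open>q = 1\<close>.\<close>
      then show ?thesis
        using equal[OF rows(2,3)] factor_nonzero[of i] q_square by auto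
    qed
    obtain k w where kw: "a (k, w) \<noteq> 0"
      using a_nonzero by (auto simp: fun_eq_iff)
    have "scale (1 / l k) b = a"
    proof
      fix x :: "nat \<times> nat"
      obtain i j where "x = (i, j)"
        by (cases x)
      then show "scale (1 / l k) b x = a x"
        using equal[OF kw, of i j] factor_nonzero[of k]
        by (cases "a (i, j) = 0") (auto simp: scale_def factor)
    qed
    then have "a \<in> P'"
      using scaled[of "1 / l k"] factor_nonzero by simp
    then show ?thesis
      using staircase_diag_rows[of a n, OF range stair]
      by (intro bexI[OF _ aP] bexI[OF _ \<open>a \<in> P'\<close>] disjI2) simp
  qed
qed

end
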